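(* If $P$ is a nuclear-enabled meet-semilattice, then the set $\mathrm{NucSys}(P)$ of all nuclear systems in $P$ is a closure system in the powerset lattice $\mathcal{P}(P)$, determined by the set of closure rules $\mathrm{R}_{\mathrm{df}}(P)\cup\mathrm{R}_{\mathrm{nuc}}(P)$; that is, a subset of $P$ is a nuclear system in $P$ if and only if it obeys every closure rule in $\mathrm{R}_{\mathrm{df}}(P)\cup\mathrm{R}_{\mathrm{nuc}}(P)$.
   Context: A meet-semilattice is a poset in which any two elements have a meet. A poset has a ceiling if each of its elements is below some maximal element of it; a subset of a poset has a ceiling if it does so as a subposet. A poset $P$ is default-enabled if for every subset $X\subseteq P$ (including $X=\emptyset$) the set of all lower bounds of $X$ in $P$ has a ceiling. For $a,b$ in a meet-semilattice $P$, let $(a\mathbin{\overset{*}{\Rightarrow}}b)=\{x\in P: x\wedge a\le b\}$ and let $(a\mathbin{\overset{.}{\Rightarrow}}b)$ be the set of all maximal elements of $(a\mathbin{\overset{*}{\Rightarrow}}b)$. A meet-semilattice $P$ is nuclear-enabled if it is default-enabled and every set $(a\mathbin{\overset{*}{\Rightarrow}}b)$ with $a,b\in P$ has a ceiling. A closure rule on a set $E$ is a pair $(B,c)$ with $B\subseteq E$, $c\in E$; a subset $X\subseteq E$ obeys it if $B\subseteq X$ implies $c\in X$. The closure system in $\mathcal{P}(E)$ determined by a set $R$ of closure rules is the set of all subsets of $E$ that obey every rule in $R$. A closure system in $\mathcal{P}(E)$ is a set of subsets of $E$ closed under arbitrary intersections (with the empty intersection being $E$). $\mathrm{R}_{\mathrm{df}}(P)$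 is the set of all default closure rules on $P$: the rules $(B,c)$ where $c$ is a maximal lower bound of $B$ in $P$. $\mathrm{R}_{\mathrm{nuc}}(P)$ is the set of all nuclear closure rules on $P$: the rules $(\{b\},c)$ such that $c\in(a\mathbin{\overset{.}{\Rightarrow}}b)$ for some $a\in P$. A nucleus on $P$ is a map $P\to P$ that is increasing, ascending ($x\le\gamma(x)$), idempotent and preserves binary meets; a nuclear system in $P$ is the fixpoint set of a nucleus on $P$. *)

theory Defs
  imports "HOL-Algebra.Complete_Lattice"
begin

text \<open>
  Posets are HOL-Algebra order structures, with an explicit (possibly empty) carrier; a
  meet-semilattice is an instance of the locale \<^locale>\<open>lower_semilattice\<close>.
\<close>

definition maximal_elements :: "('a, 'b) gorder_scheme \<Rightarrow> 'a set \<Rightarrow> 'a set" where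
  "maximal_elements P A = {m \<in> A. \<forall>x\<in>A. m \<sqsubseteq>\<^bsub>P\<^esub> x \<longrightarrow> x = m}"

definition has_ceiling :: "('a, 'b) gorder_scheme \<Rightarrow> 'a set \<Rightarrow> bool" where
  "has_ceiling P A \<longleftrightarrow> (\<forall>x\<in>A. \<exists>m\<in>maximal_elements P A. x \<sqsubseteq>\<^bsub>P\<^esub> m)"

definition default_enabled :: "('a, 'b) gorder_scheme \<Rightarrow> bool" where
  "default_enabled P \<longleftrightarrow> (\<forall>X. X \<subseteq> carrier P \<longrightarrow> has_ceiling P (Lower P X))"

definition star_arrow :: "('a, 'b) gorder_scheme \<Rightarrow> 'a \<Rightarrow> 'a \<Rightarrow> 'a set" where
  "star_arrow P a b = {x \<in> carrier P. x \<sqinter>\<^bsub>P\<^esub> a \<sqsubseteq>\<^bsub>P\<^esub> b}"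

definition dot_arrow :: "('a, 'b) gorder_scheme \<Rightarrow> 'a \<Rightarrow> 'a \<Rightarrow> 'a set" where
  "dot_arrow P a b = maximal_elements P (star_arrow P a b)"

definition nuclear_enabled :: "('a, 'b) gorder_scheme \<Rightarrow> bool" where
  "nuclear_enabled P \<longleftrightarrow> default_enabled P \<and>
     (\<forall>a\<in>carrier P. \<forall>b\<in>carrier P. has_ceiling P (star_arrow P a b))"

type_synonym 'a closure_rule = "'a set \<times> 'a"

definition obeys :: "'a set \<Rightarrow> 'a closure_rule \<Rightarrow> bool" where
  "obeys X r \<longleftrightarrow> (fst r \<subseteq> X \<longrightarrow> snd r \<in> X)"

definition determined_system :: "'a set \<Rightarrow> 'a closure_rule set \<Rightarrow> 'a set set" where
  "determined_system E R = {X. X \<subseteq> E \<and> (\<forall>r\<in>R. obeys X r)}"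

text \<open>Intersecting with \<^term>\<open>E\<close> makes the empty intersection equal to \<^term>\<open>E\<close> instead of the
  whole type.\<close>

definition closure_system :: "'a set \<Rightarrow> 'a set set \<Rightarrow> bool" where
  "closure_system E S \<longleftrightarrow> S \<subseteq> Pow E \<and> (\<forall>T. T \<subseteq> S \<longrightarrow> E \<inter> \<Inter>T \<in> S)"

definition R_df :: "('a, 'b) gorder_scheme \<Rightarrow> 'a closure_rule set" where
  "R_df P = {(B, c). B \<subseteq> carrier P \<and> c \<in> maximal_elements P (Lower P B)}"

definition R_nuc :: "('a, 'b) gorder_scheme \<Rightarrow> 'a closure_rule set" where
  "R_nuc P = {({b}, c) |b c. b \<in> carrier P \<and> (\<exists>a\<in>carrier P. c \<in> dot_arrow P a b)}"

definition nucleus :: "('a, 'b) gorder_scheme \<Rightarrow> ('a \<Rightarrow> 'a) \<Rightarrow> bool" where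
  "nucleus P g \<longleftrightarrow>
     g \<in> carrier P \<rightarrow> carrier P \<and>
     Mono\<^bsub>P\<^esub> g \<and>
     (\<forall>x\<in>carrier P. x \<sqsubseteq>\<^bsub>P\<^esub> g x) \<and>
     Idem\<^bsub>P\<^esub> g \<and>
     (\<forall>x\<in>carrier P. \<forall>y\<in>carrier P. g (x \<sqinter>\<^bsub>P\<^esub> y) = g x \<sqinter>\<^bsub>P\<^esub> g y)"

definition NucSys :: "('a, 'b) gorder_scheme \<Rightarrow> 'a set set" where
  "NucSys P = {fps P g |g. nucleus P g}"

end

theory Submission
  imports Defs
begin

text \<open>
  Default rules say exactly that every element \<open>a\<close> has a least element of \<open>X\<close> above it: a maximal
  lower bound of \<open>{x \<in> X. a \<sqsubseteq> x}\<close> lying above \<open>a\<close> is forced into \<open>X\<close>. Nuclear rules then make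
  the resulting closure operator \<open>\<gamma>\<close> preserve meets: if \<open>x \<sqinter> y \<sqsubseteq> z \<in> X\<close>, a maximal solution
  \<open>m \<sqsupseteq> x\<close> of \<open>m \<sqinter> y \<sqsubseteq> z\<close> lies in \<open>X\<close>, hence \<open>\<gamma> x \<sqsubseteq> m\<close> and \<open>\<gamma> x \<sqinter> y \<sqsubseteq> z\<close>; repeating this in
  the other argument gives \<open>\<gamma> x \<sqinter> \<gamma> y \<sqsubseteq> z\<close>. Conversely, a nucleus maps the set of lower bounds of
  a set of fixpoints into itself, and likewise the set of solutions of \<open>x \<sqinter> a \<sqsubseteq> b\<close> for a fixpoint
  \<open>b\<close>, so it fixes the maximal elements of these sets.
\<close>

text \<open>A premise contained in the intersection lies in every member of \<open>T\<close>, so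
  each member contains the conclusion. The hypothesis on \<open>R\<close> handles the factor
  \<open>E\<close>, in particular when \<open>T\<close> is empty.\<close>

lemma closure_system_determined_system:
  assumes "\<And>B c. (B, c) \<in> R \<Longrightarrow> c \<in> E"
  shows "closure_system E (determined_system E R)"
  unfolding closure_system_def
proof (intro conjI allI impI)
  show "determined_system E R \<subseteq> Pow E"
    by (auto simp: determined_system_def)
next
  fix T assume T: "T \<subseteq> determined_system E R"
  have "obeys (E \<inter> \<Inter>T) (B, c)" if r: "(B, c) \<in> R" for B c
    unfolding obeys_def fst_conv snd_conv
  proof
    assume B: "B \<subseteq> E \<inter> \<Inter>T"
    have "c \<in> X" if "X \<in> T" for X
    proof -
      have "obeys X (B, c)" using that T r by (auto simp: determined_system_def)
      moreover have "B \<subseteq> X" using B that by blast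
      ultimately show ?thesis by (simp add: obeys_def)
    qed
    with assms[OF r] show "c \<in> E \<inter> \<Inter>T" by blast
  qed
  then show "E \<inter> \<Inter>T \<in> determined_system E R"
    by (auto simp: determined_system_def)
qed

lemma maximal_elements_fixed:
  assumes "m \<in> maximal_elements P A" "g m \<in> A" "m \<sqsubseteq>\<^bsub>P\<^esub> g m"
  shows "g m = m"
  using assms by (auto simp: maximal_elements_def)

context lower_semilattice
begin

lemma nucleus_fixpoints_obey:
  assumes g: "nucleus L g" and r: "r \<in> R_df L \<union> R_nuc L"
  shows "obeys (fps L g) r"
proof -
  have closed: "g x \<in> carrier L" if "x \<in> carrier L" for x
    using g that by (auto simp: nucleus_def)
  have mono: "g x \<sqsubseteq> g y" if "x \<in> carrier L" "y \<in> carrier L" "x \<sqsubseteq> y" for x y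
    using g that by (auto simp: nucleus_def isotone_def)
  have asc: "x \<sqsubseteq> g x" if "x \<in> carrier L" for x
    using g that by (auto simp: nucleus_def)
  have meet: "g (x \<sqinter> y) = g x \<sqinter> g y" if "x \<in> carrier L" "y \<in> carrier L" for x y
    using g that by (auto simp: nucleus_def)
  have fix_iff: "x \<in> fps L g \<longleftrightarrow> x \<in> carrier L \<and> g x = x" for x
    by (auto simp: fps_def eq_is_equal)
  from r show ?thesis
  proof
    assume "r \<in> R_df L"
    then obtain B c where rBc: "r = (B, c)" and B: "B \<subseteq> carrier L"
      and c: "c \<in> maximal_elements L (Lower L B)"
      by (auto simp: R_df_def)
    have cL: "c \<in> carrier L" and c_lower: "\<And>b. b \<in> B \<Longrightarrow> c \<sqsubseteq> b"
      using c B by (auto simp: maximal_elements_def Lower_def)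
    have "c \<in> fps L g" if "B \<subseteq> fps L g"
    proof -
      have "g c \<sqsubseteq> b" if "b \<in> B" for b
        using mono[OF cL _ c_lower[OF that]] B \<open>B \<subseteq> fps L g\<close> that
        by (auto simp: fix_iff subset_iff)
      then have "g c \<in> Lower L B"
        using closed[OF cL] by (auto simp: Lower_def)
      then show ?thesis
        using maximal_elements_fixed[where g = g, OF c _ asc[OF cL]] cL by (simp add: fix_iff)
    qed
    then show ?thesis by (simp add: rBc obeys_def)
  next
    assume "r \<in> R_nuc L"
    then obtain a b c where rbc: "r = ({b}, c)" and b: "b \<in> carrier L" and a: "a \<in> carrier L"
      and c: "c \<in> maximal_elements L (star_arrow L a b)"
      by (auto simp: R_nuc_def dot_arrow_def)
    have cL: "c \<in> carrier L" and c_sol: "c \<sqinter> a \<sqsubseteq> b"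
      using c by (auto simp: maximal_elements_def star_arrow_def)
    have "c \<in> fps L g" if "b \<in> fps L g"
    proof -
      note cl = a b cL closed[OF a] closed[OF cL]
      \<comment> \<open>Enlarging \<open>a\<close> to \<open>g a\<close> lets meet preservation pull
        \<open>g\<close> out; isotony then gives
        \<open>g (c \<sqinter> a) \<sqsubseteq> g b = b\<close>.\<close>
      have "g c \<sqinter> a \<sqsubseteq> g c \<sqinter> g a"
        by (intro meet_le meet_left le_trans[OF meet_right asc]) (simp_all add: cl)
      also have "\<dots> = g (c \<sqinter> a)" using meet[OF cL a] by simp
      also have "\<dots> \<sqsubseteq> b"
        using mono[OF _ b c_sol] cl that by (simp add: fix_iff)
      finally have "g c \<in> star_arrow L a b"
        using cl closed[of "c \<sqinter> a"] by (simp add: star_arrow_def)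
      then show ?thesis
        using maximal_elements_fixed[where g = g, OF c _ asc[OF cL]] cL by (simp add: fix_iff)
    qed
    then show ?thesis by (simp add: rbc obeys_def)
  qed
qed

lemma least_above_exists:
  assumes de: "default_enabled L" and X: "X \<subseteq> carrier L"
    and rules: "\<And>r. r \<in> R_df L \<Longrightarrow> obeys X r" and a: "a \<in> carrier L"
  shows "\<exists>c\<in>X. a \<sqsubseteq> c \<and> (\<forall>x\<in>X. a \<sqsubseteq> x \<longrightarrow> c \<sqsubseteq> x)"
proof -
  define U where "U = {x \<in> X. a \<sqsubseteq> x}"
  have U: "U \<subseteq> carrier L" "U \<subseteq> X" using X by (auto simp: U_def)
  have "a \<in> Lower L U" using a by (auto simp: Lower_def U_def)
  then obtain c where c: "c \<in> maximal_elements L (Lower L U)" "a \<sqsubseteq> c"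
    using de U unfolding default_enabled_def has_ceiling_def by blast
  \<comment> \<open>\<open>U\<close> may be empty: then \<open>c\<close> is a maximal element of the
    whole carrier, and the rule with empty premise puts it into \<open>X\<close>.\<close>
  have "(U, c) \<in> R_df L" using c U by (simp add: R_df_def)
  then have "c \<in> X" using rules U by (force simp: obeys_def)
  moreover have "c \<sqsubseteq> x" if "x \<in> X" "a \<sqsubseteq> x" for x
    using c that X by (auto simp: maximal_elements_def Lower_def U_def)
  ultimately show ?thesis using c by blast
qed

lemma obeying_set_is_nuclear_system:
  assumes ne: "nuclear_enabled L" and X: "X \<subseteq> carrier L"
    and rules: "\<And>r. r \<in> R_df L \<union> R_nuc L \<Longrightarrow> obeys X r"
  shows "X \<in> NucSys L"
proof -
  have "\<forall>a\<in>carrier L. \<exists>c. c \<in> X \<and> a \<sqsubseteq> c \<and> (\<forall>x\<in>X. a \<sqsubseteq> x \<longrightarrow> c \<sqsubseteq> x)"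
    using least_above_exists[OF _ X] ne rules unfolding nuclear_enabled_def by blast
  \<comment> \<open>This is the closure operator \<open>\<gamma>\<close> of the overview; its values
    outside the carrier are arbitrary.\<close>
  then obtain g where g: "\<And>a. a \<in> carrier L \<Longrightarrow>
      g a \<in> X \<and> a \<sqsubseteq> g a \<and> (\<forall>x\<in>X. a \<sqsubseteq> x \<longrightarrow> g a \<sqsubseteq> x)"
    by metis
  have gX: "g a \<in> X" and asc: "a \<sqsubseteq> g a" and closed: "g a \<in> carrier L"
    if "a \<in> carrier L" for a
    using g[OF that] X by auto
  have least: "g a \<sqsubseteq> x" if "a \<in> carrier L" "x \<in> X" "a \<sqsubseteq> x" for a x
    using g that by blast
  have fixed: "g x = x" if "x \<in> X" for x
    using that X closed[of x] asc[of x] least[of x x] by (auto intro: le_antisym)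
  \<comment> \<open>\<open>g y\<close> is an element of \<open>X\<close> above \<open>x\<close>, so
    leastness of \<open>g x\<close> applies.\<close>
  have mono: "g x \<sqsubseteq> g y" if "x \<in> carrier L" "y \<in> carrier L" "x \<sqsubseteq> y" for x y
    using that by (intro least gX le_trans[OF _ asc]) (auto simp: closed)
  \<comment> \<open>The bound \<open>z\<close> is kept independent of \<open>x\<close> and
    \<open>y\<close>: the second use below is for the pair \<open>y\<close>, \<open>g x\<close>,
    still with bound \<open>g (x \<sqinter> y)\<close>.\<close>
  have shift: "g x \<sqinter> y \<sqsubseteq> z"
    if x: "x \<in> carrier L" and y: "y \<in> carrier L" and z: "z \<in> X" and le: "x \<sqinter> y \<sqsubseteq> z" for x y z
  proof -
    have zL: "z \<in> carrier L" using z X by blast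
    have "x \<in> star_arrow L y z" using x le by (simp add: star_arrow_def)
    then obtain m where m: "m \<in> dot_arrow L y z" "x \<sqsubseteq> m"
      using ne y zL unfolding nuclear_enabled_def has_ceiling_def dot_arrow_def by blast
    have "({z}, m) \<in> R_nuc L" using m y zL by (auto simp: R_nuc_def)
    then have "m \<in> X" using rules z by (force simp: obeys_def)
    then have gm: "g x \<sqsubseteq> m" using least x m by blast
    have mL: "m \<in> carrier L" and mz: "m \<sqinter> y \<sqsubseteq> z"
      using m by (auto simp: dot_arrow_def maximal_elements_def star_arrow_def)
    have "g x \<sqinter> y \<sqsubseteq> m \<sqinter> y"
      by (intro meet_le le_trans[OF meet_left gm] meet_right)
        (simp_all add: closed x y mL)
    then show ?thesis using mz by (rule le_trans) (simp_all add: closed x y mL zL)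
  qed
  have meet: "g (x \<sqinter> y) = g x \<sqinter> g y" if x: "x \<in> carrier L" and y: "y \<in> carrier L" for x y
  proof (rule le_antisym)
    show "g (x \<sqinter> y) \<sqsubseteq> g x \<sqinter> g y"
      by (intro meet_le mono meet_left meet_right) (simp_all add: closed x y)
    have "g x \<sqinter> y \<sqsubseteq> g (x \<sqinter> y)"
      by (intro shift gX asc) (simp_all add: x y)
    \<comment> \<open>Now \<open>y\<close> is the argument being closed, and \<open>g x\<close> is
      the other factor.\<close>
    then have "g y \<sqinter> g x \<sqsubseteq> g (x \<sqinter> y)"
      by (intro shift gX) (simp_all add: closed x y meet_comm)
    then show "g x \<sqinter> g y \<sqsubseteq> g (x \<sqinter> y)" by (simp add: meet_comm)
  qed (simp_all add: closed x y)
  have "nucleus L g"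
    unfolding nucleus_def isotone_def idempotent_def
    using closed mono asc meet fixed gX weak_partial_order_axioms by (auto simp: eq_is_equal)
  moreover have "fps L g = X"
  proof
    \<comment> \<open>A fixpoint is a value of \<open>g\<close>, and these lie in
      \<open>X\<close>.\<close>
    show "fps L g \<subseteq> X" using gX by (force simp: fps_def eq_is_equal)
    show "X \<subseteq> fps L g" using fixed X by (auto simp: fps_def eq_is_equal)
  qed
  ultimately show ?thesis unfolding NucSys_def by blast
qed

end

theorem proposition8p7:
  fixes P :: "('a, 'b) gorder_scheme"
  assumes "lower_semilattice P"
    and "nuclear_enabled P"
  shows "closure_system (carrier P) (NucSys P) \<and>
    NucSys P = determined_system (carrier P) (R_df P \<union> R_nuc P) \<and>
    (\<forall>X. X \<subseteq> carrier P \<longrightarrow>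
      (X \<in> NucSys P \<longleftrightarrow> (\<forall>r\<in>R_df P \<union> R_nuc P. obeys X r)))"
proof -
  interpret lower_semilattice P by fact
  have eq: "NucSys P = determined_system (carrier P) (R_df P \<union> R_nuc P)"
  proof
    show "NucSys P \<subseteq> determined_system (carrier P) (R_df P \<union> R_nuc P)"
      unfolding NucSys_def determined_system_def
      by (intro subsetI) (elim CollectE exE conjE, simp add: nucleus_fixpoints_obey del: Un_iff)
    show "determined_system (carrier P) (R_df P \<union> R_nuc P) \<subseteq> NucSys P"
      using obeying_set_is_nuclear_system[OF assms(2)] by (auto simp: determined_system_def)
  qed
  \<comment> \<open>\<open>Lower\<close> and \<open>star_arrow\<close> are cut down to the carrier,
    which supplies the hypothesis of \<open>closure_system_determined_system\<close>.\<close>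
  have "c \<in> carrier P" if "(B, c) \<in> R_df P \<union> R_nuc P" for B c
    using that by (auto simp: R_df_def R_nuc_def dot_arrow_def maximal_elements_def
        star_arrow_def Lower_def)
  then have "closure_system (carrier P) (NucSys P)"
    unfolding eq by (rule closure_system_determined_system)
  then show ?thesis
    using eq by (auto simp: determined_system_def)
qed

end
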